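(* Let $(A,B,p,r,c)$ be an LPP situation with producer set $N$, let $(N,R)$ be a common-pool resource game associated with it, and let $(N,v^R)$ be the corresponding LPP game, $v^R(S)=\mathrm{value}(S;R(S))$ for $S\subseteq N$. Suppose $d_N>r$. If $C(R)\neq\varnothing$, then $C(v^R)\neq\varnothing$.
   Context: LPP situation (linear production situation with a common-pool resource). $N=\{1,\dots,n\}$ is a set of producers, $G=\{1,\dots,g\}$ a set of goods, $Q=\{1,\dots,q\}$ a set of resources; in addition there is one external common-pool resource, of which a total amount $r\ge 0$ is available at unit cost $c\ge 0$. Producer $i$ owns $b^i\in\mathbb{R}_+^q$; $b^S=\sum_{i\in S}b^i$; $B$ is the $q\times n$ matrix with columns $b^i$, and for every $t\in Q$ there is a producer $i$ with $b^i_t>0$. $A$ is a nonnegative $(q+1)\times g$ matrix ($a_{tj}$ is the amount of resource $t$ needed per unit of good $j$; row $q+1$ refers to the common-pool resource), with $a_{(q+1)j}>0$ for all $j\in G$ and, for every $j\in G$, some $t\in Q$ with $a_{tj}>0$. $p\in\mathbb{R}_{++}^g$ is the price vector and $p_j>a_{(q+1)j}c$ for all $j\in G$. For a coalition $S\subseteq N$ and $z\ge 0$, $$\mathrm{value}(S;z)=\max\Big\{\sum_{j=1}^g p_jx_j-cz \;:\; Ax\le \begin{pmatrix} b^S\\ z\end{pmatrix},\ x\in\mathbb{R}^g_+\Big\}.$$ The optimal demand of $S$ is $d_S=\min\{z\ge 0:\ \mathrm{value}(S;z)=\max_{z'\ge 0}\mathrm{value}(S;z')\}$. It is assumed that for every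 nonempty $S$ there is $z$ with $\mathrm{value}(S;z)>0$ (so $d_S>0$). Common-pool resource game. Let $R^{opt}(S)=\min\{d_S,r\}$ and $$R^{pes}(S)=\min\Big\{\min_{P:\,S\in P}\Big(r-\sum_{T\in P,\,T\ne S}d_T\Big)_+,\ d_S\Big\}$$ for nonempty $S\subseteq N$, where $P$ ranges over partitions of $N$ containing $S$ and $(a)_+=\max\{a,0\}$. A common-pool resource game $(N,R)$ is a game in characteristic function form with $R(\varnothing)=0$ and $R^{pes}(S)\le R(S)\le R^{opt}(S)$ for all nonempty $S$ ($R(S)$ is the amount of the common-pool resource that $S$ expects to receive). In particular $R(N)=\min\{d_N,r\}$. The core of a game $(N,w)$ is $C(w)=\{x\in\mathbb{R}^N: \sum_{i\in N}x_i=w(N),\ \sum_{i\in S}x_i\ge w(S)\ \forall S\subseteq N\}$. *)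

theory Defs
  imports "HOL-Analysis.Analysis" "HOL-Library.Disjoint_Sets"
begin

text \<open>
  Producers, goods and resources are indexed by finite types \<open>'n\<close>, \<open>'g\<close> and \<open>'q\<close>; a coalition is
  a value of type \<open>'n set\<close> and the grand coalition is \<open>UNIV\<close>. The \<open>q + 1\<close> rows of the technology
  matrix are indexed by \<open>'q option\<close>: row \<open>Some t\<close> belongs to the owned resource \<open>t\<close> and row \<open>None\<close>
  to the common-pool resource.
\<close>

definition coalition_bundle :: "real^'n^'q \<Rightarrow> 'n set \<Rightarrow> real^'q" where
  "coalition_bundle B S = (\<Sum>i\<in>S. column i B)"

definition resource_limits :: "real^'q \<Rightarrow> real \<Rightarrow> real^('q::finite option)" where
  "resource_limits b z = (\<chi> k. case k of Some t \<Rightarrow> b $ t | None \<Rightarrow> z)"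

text \<open>
  Maxima and minima over infinite sets of reals are written with \<open>GREATEST\<close> and \<open>LEAST\<close>. For an
  LPP situation (below) all of those used here are attained. The order on vectors is componentwise.
\<close>

definition lpp_value ::
  "real^'g^('q::finite option) \<Rightarrow> real^'n^'q \<Rightarrow> real^'g \<Rightarrow> real \<Rightarrow> 'n set \<Rightarrow> real \<Rightarrow> real" where
  "lpp_value A B p c S z =
     (GREATEST v. \<exists>x. 0 \<le> x \<and> A *v x \<le> resource_limits (coalition_bundle B S) z \<and>
                      v = p \<bullet> x - c * z)"

definition optimal_demand ::
  "real^'g^('q::finite option) \<Rightarrow> real^'n^'q \<Rightarrow> real^'g \<Rightarrow> real \<Rightarrow> 'n set \<Rightarrow> real" where
  "optimal_demand A B p c S =
     (LEAST z. 0 \<le> z \<and>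
        lpp_value A B p c S z = (GREATEST v. \<exists>z'\<ge>0. v = lpp_value A B p c S z'))"

locale lpp_situation =
  fixes A :: "real^'g^('q::finite option)"
    and B :: "real^'n^'q"
    and p :: "real^'g"
    and r c :: real
  assumes A_nonneg: "\<And>k j. 0 \<le> A $ k $ j"
    and A_pool_pos: "\<And>j. 0 < A $ None $ j"
    and A_owned_pos: "\<And>j. \<exists>t. 0 < A $ Some t $ j"
    and B_nonneg: "\<And>t i. 0 \<le> B $ t $ i"
    and B_pos: "\<And>t. \<exists>i. 0 < B $ t $ i"
    and p_pos: "\<And>j. 0 < p $ j"
    and r_nonneg: "0 \<le> r"
    and c_nonneg: "0 \<le> c"
    and p_gt_cost: "\<And>j. A $ None $ j * c < p $ j"
    and value_pos: "\<And>S. S \<noteq> {} \<Longrightarrow> \<exists>z\<ge>0. 0 < lpp_value A B p c S z"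

definition R_opt ::
  "real^'g^('q::finite option) \<Rightarrow> real^'n^'q \<Rightarrow> real^'g \<Rightarrow> real \<Rightarrow> real \<Rightarrow> 'n set \<Rightarrow> real" where
  "R_opt A B p r c S = min (optimal_demand A B p c S) r"

definition R_pes ::
  "real^'g^('q::finite option) \<Rightarrow> real^'n^'q \<Rightarrow> real^'g \<Rightarrow> real \<Rightarrow> real \<Rightarrow> 'n set \<Rightarrow> real" where
  "R_pes A B p r c S =
     min (Min ((\<lambda>P. max (r - (\<Sum>T\<in>P - {S}. optimal_demand A B p c T)) 0) `
               {P. partition_on UNIV P \<and> S \<in> P}))
         (optimal_demand A B p c S)"

definition common_pool_resource_game ::
  "real^'g^('q::finite option) \<Rightarrow> real^'n^'q \<Rightarrow> real^'g \<Rightarrow> real \<Rightarrow> real \<Rightarrow> ('n set \<Rightarrow> real) \<Rightarrow> bool"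
  where
  "common_pool_resource_game A B p r c R \<longleftrightarrow>
     R {} = 0 \<and> (\<forall>S. S \<noteq> {} \<longrightarrow> R_pes A B p r c S \<le> R S \<and> R S \<le> R_opt A B p r c S)"

definition lpp_game ::
  "real^'g^('q::finite option) \<Rightarrow> real^'n^'q \<Rightarrow> real^'g \<Rightarrow> real \<Rightarrow> ('n set \<Rightarrow> real) \<Rightarrow> 'n set \<Rightarrow> real"
  where
  "lpp_game A B p c R S = lpp_value A B p c S (R S)"

definition core :: "('n::finite set \<Rightarrow> real) \<Rightarrow> (real^'n) set" where
  "core w = {x. (\<Sum>i\<in>UNIV. x $ i) = w UNIV \<and> (\<forall>S. w S \<le> (\<Sum>i\<in>S. x $ i))}"

end

theory Submission imports Defs begin

text \<open>
  Let \<open>y\<close> be a core element of \<open>R\<close>, and let \<open>\<pi>\<close> be an optimal dual solution (shadow prices) of the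
  linear program of the grand coalition with resources \<open>b\<^sup>N\<close> and \<open>r\<close>. Paying producer \<open>i\<close> the value
  of \<open>b\<^sup>i\<close> and of \<open>y\<^sub>i\<close> units of the common-pool resource at the prices \<open>\<pi>\<close>, minus \<open>c y\<^sub>i\<close>,
  distributes exactly the value of the grand coalition. By weak duality a coalition \<open>S\<close> cannot
  improve upon this, as soon as the shadow price of the common-pool resource is at least \<open>c\<close>;
  and this follows from \<open>r < d\<^sub>N\<close>, since at a smaller price no demand above \<open>r\<close> could be strictly
  profitable.
\<close>

section \<open>Componentwise order and resource vectors\<close>

lemma inner_nonneg_vec:
  fixes u v :: "real^'k"
  assumes "0 \<le> u" "0 \<le> v"
  shows "0 \<le> u \<bullet> v"
  using assms by (auto simp: inner_vec_def less_eq_vec_def intro!: sum_nonneg)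

lemma inner_left_mono_vec:
  fixes u v w :: "real^'k"
  assumes "0 \<le> u" "v \<le> w"
  shows "u \<bullet> v \<le> u \<bullet> w"
proof -
  have "0 \<le> u \<bullet> (w - v)"
    using assms by (intro inner_nonneg_vec) (auto simp: less_eq_vec_def)
  then show ?thesis
    by (simp add: inner_diff_right)
qed

lemma matrix_vector_mult_nonneg:
  fixes A :: "real^'g^'k"
  assumes "\<And>k j. 0 \<le> A $ k $ j" "0 \<le> x"
  shows "0 \<le> A *v x"
  using assms by (auto simp: less_eq_vec_def matrix_vector_mult_def intro!: sum_nonneg)

lemma resource_limits_nth [simp]:
  "resource_limits b z $ Some t = b $ t" "resource_limits b z $ None = z"
  by (simp_all add: resource_limits_def)

lemma le_resource_limits_iff:
  "y \<le> resource_limits b z \<longleftrightarrow> (\<forall>t. y $ Some t \<le> b $ t) \<and> y $ None \<le> z"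
  by (auto simp: less_eq_vec_def resource_limits_def split: option.split)

lemma sum_resource_limits:
  "(\<Sum>i\<in>S. resource_limits (f i) (h i)) = resource_limits (\<Sum>i\<in>S. f i) (\<Sum>i\<in>S. h i)"
  by (auto simp: vec_eq_iff resource_limits_def split: option.split)

lemma resource_limits_pool_add:
  "resource_limits b (z + s) = resource_limits b z + axis None s"
  by (auto simp: vec_eq_iff resource_limits_def axis_def split: option.split)

lemma coalition_bundle_nth: "coalition_bundle B S $ t = (\<Sum>i\<in>S. B $ t $ i)"
  by (simp add: coalition_bundle_def column_def)

section \<open>Strong duality\<close>

text \<open>
  Separates the hypograph \<open>{(y, t). t \<le> max {p \<bullet> x | A x \<le> y}}\<close> of the value function from the open
  ray above the optimum at \<open>b\<close>; since \<open>b > 0\<close>, the hyperplane is not vertical.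
\<close>
lemma lp_shadow_prices:
  fixes A :: "real^'g^'k" and p :: "real^'g"
  assumes b: "\<And>k. 0 < b $ k"
    and opt: "\<And>x. 0 \<le> x \<Longrightarrow> A *v x \<le> b \<Longrightarrow> p \<bullet> x \<le> V"
  obtains \<pi> where "0 \<le> \<pi>" "\<And>x. 0 \<le> x \<Longrightarrow> p \<bullet> x \<le> \<pi> \<bullet> (A *v x)" "\<pi> \<bullet> b \<le> V"
proof -
  define K where "K = {(y, t). \<exists>x. 0 \<le> x \<and> A *v x \<le> y \<and> t \<le> p \<bullet> x}"
  have KI: "(y, t) \<in> K" if "0 \<le> x" "A *v x \<le> y" "t \<le> p \<bullet> x" for x y t
    using that by (auto simp: K_def)
  have "convex K"
  proof (rule convexI)
    fix a a' :: "(real^'k) \<times> real" and u v :: real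
    assume "a \<in> K" "a' \<in> K" and uv: "0 \<le> u" "0 \<le> v" "u + v = 1"
    then obtain x y t x' y' t' where a: "a = (y, t)" "a' = (y', t')"
      and x: "0 \<le> x" "A *v x \<le> y" "t \<le> p \<bullet> x" and x': "0 \<le> x'" "A *v x' \<le> y'" "t' \<le> p \<bullet> x'"
      by (auto simp: K_def)
    have "0 \<le> u *\<^sub>R x + v *\<^sub>R x'"
      using x x' uv by (auto simp: less_eq_vec_def)
    moreover have "A *v (u *\<^sub>R x + v *\<^sub>R x') \<le> u *\<^sub>R y + v *\<^sub>R y'"
      using x x' uv
      by (auto simp: less_eq_vec_def matrix_vector_right_distrib matrix_vector_mult_scaleR
          intro!: add_mono mult_left_mono)
    moreover have "u * t + v * t' \<le> p \<bullet> (u *\<^sub>R x + v *\<^sub>R x')"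
      using x x' uv by (auto simp: inner_add_right intro!: add_mono mult_left_mono)
    ultimately show "u *\<^sub>R a + v *\<^sub>R a' \<in> K"
      unfolding a by (simp add: KI)
  qed
  moreover have "convex ({b} \<times> {V<..})"
    by (intro convex_Times) auto
  moreover have "K \<inter> {b} \<times> {V<..} = {}"
    using opt by (fastforce simp: K_def)
  moreover have K0: "(0, 0) \<in> K"
    by (rule KI[of 0]) auto
  ultimately obtain a \<beta> where a: "a \<noteq> 0" and le: "\<And>w. w \<in> K \<Longrightarrow> a \<bullet> w \<le> \<beta>"
    and ge: "\<And>w. w \<in> {b} \<times> {V<..} \<Longrightarrow> \<beta> \<le> a \<bullet> w"
    using separating_hyperplane_sets[of K "{b} \<times> {V<..}"] by (metis (no_types) SigmaI
      empty_iff greaterThan_iff gt_ex singletonI)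
  obtain l m where lm: "a = (l, m)"
    by (cases a)
  have leK: "l \<bullet> y + m * t \<le> \<beta>" if "(y, t) \<in> K" for y t
    using le[OF that] by (simp add: lm)
  have \<beta>0: "0 \<le> \<beta>"
    using leK[OF K0] by simp
  \<comment> \<open>The ray above \<open>V\<close> is open, so the bound at \<open>V\<close> itself
    comes from letting \<open>t\<close> decrease to \<open>V\<close>.\<close>
  have \<beta>V: "\<beta> \<le> l \<bullet> b + m * V"
  proof (rule tendsto_lowerbound)
    show "((\<lambda>t. l \<bullet> b + m * t) \<longlongrightarrow> l \<bullet> b + m * V) (at_right V)"
      by (intro tendsto_intros)
    show "\<forall>\<^sub>F t in at_right V. \<beta> \<le> l \<bullet> b + m * t"
      using ge by (auto simp: lm eventually_at_filter)
  qed auto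
  \<comment> \<open>\<open>K\<close> is closed under lowering \<open>t\<close> and raising
    \<open>y\<close>, which fixes the signs of \<open>m\<close> and \<open>l\<close>. Each test
    point is scaled so that its product with \<open>(l, m)\<close> is \<open>\<beta> + 1\<close>,
    violating \<open>leK\<close>.\<close>
  have m0: "0 \<le> m"
  proof (rule ccontr)
    assume "\<not> 0 \<le> m"
    moreover from this have "(0, (\<beta> + 1) / m) \<in> K"
      using \<beta>0 by (intro KI[of 0]) (auto simp: divide_nonneg_neg)
    ultimately show False
      using leK[of 0 "(\<beta> + 1) / m"] by simp
  qed
  have l0: "l $ k \<le> 0" for k
  proof (rule ccontr)
    assume k: "\<not> l $ k \<le> 0"
    then have "(axis k ((\<beta> + 1) / l $ k), 0) \<in> K"
      using \<beta>0 by (intro KI[of 0]) (auto simp: less_eq_vec_def axis_def)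
    then show False
      using leK k by (fastforce simp: inner_axis)
  qed
  \<comment> \<open>A vertical hyperplane would give \<open>0 \<le> l \<bullet> b\<close> with
    \<open>l \<le> 0\<close> and \<open>b\<close> strictly positive, hence \<open>l = 0\<close>,
    contradicting \<open>a \<noteq> 0\<close>.\<close>
  have "m \<noteq> 0"
  proof
    assume m: "m = 0"
    have "(\<Sum>k\<in>UNIV. - (l $ k) * b $ k) \<le> 0"
      using \<beta>V \<beta>0 m by (simp add: inner_vec_def sum_negf)
    moreover have nn: "0 \<le> - (l $ k) * b $ k" for k
      using l0[of k] b[of k] by (intro mult_nonneg_nonneg) auto
    ultimately have "(\<Sum>k\<in>UNIV. - (l $ k) * b $ k) = 0"
      by (meson antisym sum_nonneg)
    then have "- (l $ k) * b $ k = 0" for k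
      using nn by (subst (asm) sum_nonneg_eq_0_iff) auto
    then have "l = 0"
      using b by (metis less_irrefl mult_eq_0_iff neg_equal_0_iff_equal vec_eq_iff zero_index)
    then show False
      using a lm m by (simp add: zero_prod_def)
  qed
  with m0 have m: "0 < m"
    by simp
  \<comment> \<open>The prices are the slopes of the hyperplane solved for \<open>t\<close>, namely
    \<open>- l / m\<close>.\<close>
  show thesis
  proof
    show "0 \<le> - (1 / m) *\<^sub>R l"
      using l0 m by (auto simp: less_eq_vec_def divide_nonpos_pos)
    show "(- (1 / m) *\<^sub>R l) \<bullet> b \<le> V"
      using \<beta>V \<beta>0 m by (simp add: field_simps)
    fix x :: "real^'g" assume x: "0 \<le> x"
    show "p \<bullet> x \<le> (- (1 / m) *\<^sub>R l) \<bullet> (A *v x)"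
    proof (rule ccontr)
      \<comment> \<open>Scaling a plan keeps it in \<open>K\<close>, so a positive \<delta> could be
        magnified by \<open>s\<close> beyond the bound \<beta>.\<close>
      define \<delta> where "\<delta> = l \<bullet> (A *v x) + m * (p \<bullet> x)"
      assume "\<not> ?thesis"
      then have \<delta>: "0 < \<delta>"
        using m by (simp add: \<delta>_def field_simps)
      define s where "s = (\<beta> + 1) / \<delta>"
      have "0 \<le> s"
        using \<delta> \<beta>0 by (simp add: s_def)
      then have "(A *v (s *\<^sub>R x), p \<bullet> (s *\<^sub>R x)) \<in> K"
        using x by (intro KI[of "s *\<^sub>R x"]) (auto simp: less_eq_vec_def)
      from leK[OF this] have "s * \<delta> \<le> \<beta>"
        by (simp add: \<delta>_def matrix_vector_mult_scaleR algebra_simps)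
      then show False
        using \<delta> by (simp add: s_def)
    qed
  qed
qed

section \<open>Attainment of values and demands\<close>

context lpp_situation
begin

text \<open>The pool constraint is left out so that a single compact set serves all amounts
  \<open>z\<close>.\<close>

definition producible :: "'n set \<Rightarrow> (real^'g) set" where
  "producible S = {x. 0 \<le> x \<and> (\<forall>t. (A *v x) $ Some t \<le> coalition_bundle B S $ t)}"

lemma feasible_iff:
  "0 \<le> x \<and> A *v x \<le> resource_limits (coalition_bundle B S) z \<longleftrightarrow>
     x \<in> producible S \<and> (A *v x) $ None \<le> z"
  by (auto simp: producible_def le_resource_limits_iff)

lemma zero_producible: "0 \<in> producible S"
  by (auto simp: producible_def coalition_bundle_nth B_nonneg intro!: sum_nonneg)

text \<open>Every good consumes some owned resource, whose stock caps its output.\<close>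

lemma compact_producible: "compact (producible S)"
proof -
  obtain \<tau> where \<tau>: "\<And>j. 0 < A $ Some (\<tau> j) $ j"
    using A_owned_pos by metis
  have "x $ j \<le> coalition_bundle B S $ \<tau> j / A $ Some (\<tau> j) $ j" if "x \<in> producible S" for x j
  proof -
    have "A $ Some (\<tau> j) $ j * x $ j \<le> (\<Sum>i\<in>UNIV. A $ Some (\<tau> j) $ i * x $ i)"
      using that A_nonneg by (intro member_le_sum) (auto simp: producible_def less_eq_vec_def)
    also have "\<dots> \<le> coalition_bundle B S $ \<tau> j"
      using that by (auto simp: producible_def matrix_vector_mult_def)
    finally show ?thesis
      using \<tau>[of j] by (simp add: field_simps)
  qed
  then have "producible S \<subseteq> cbox 0 (\<chi> j. coalition_bundle B S $ \<tau> j / A $ Some (\<tau> j) $ j)"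
    by (auto simp: mem_box_cart producible_def less_eq_vec_def)
  then have "bounded (producible S)"
    using bounded_cbox bounded_subset by blast
  moreover have "closed (producible S)"
    unfolding producible_def less_eq_vec_def
    by (intro closed_Collect_conj closed_Collect_all closed_Collect_le continuous_intros
        matrix_vector_mult_linear_continuous_on continuous_on_component)
  ultimately show ?thesis
    by (simp add: compact_eq_bounded_closed)
qed

lemma pool_use_nonneg: "x \<in> producible S \<Longrightarrow> 0 \<le> (A *v x) $ None"
  using matrix_vector_mult_nonneg[of A x] A_nonneg by (auto simp: producible_def less_eq_vec_def)

text \<open>Turns the \<open>GREATEST\<close> of the definition into a true maximum;
  \<open>0 \<le> z\<close> makes the zero plan feasible.\<close>

lemma lpp_value_attained:
  assumes "0 \<le> z"
  obtains x where "x \<in> producible S" "(A *v x) $ None \<le> z" "lpp_value A B p c S z = p \<bullet> x - c * z"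
    "\<And>x'. x' \<in> producible S \<Longrightarrow> (A *v x') $ None \<le> z \<Longrightarrow> p \<bullet> x' - c * z \<le> lpp_value A B p c S z"
proof -
  let ?F = "producible S \<inter> {x. (A *v x) $ None \<le> z}"
  have "closed {x. (A *v x) $ None \<le> z}"
    by (intro closed_Collect_le continuous_intros matrix_vector_mult_linear_continuous_on
        continuous_on_component)
  then have "compact ?F"
    by (rule compact_Int_closed[OF compact_producible])
  moreover have "0 \<in> ?F"
    using zero_producible assms by simp
  ultimately obtain x where x: "x \<in> ?F" and max: "\<And>x'. x' \<in> ?F \<Longrightarrow> p \<bullet> x' \<le> p \<bullet> x"
    using continuous_attains_sup[of ?F "\<lambda>x. p \<bullet> x"] continuous_on_inner[OF continuous_on_const
      continuous_on_id] by (metis empty_iff)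
  have "lpp_value A B p c S z = p \<bullet> x - c * z"
    unfolding lpp_value_def conj_assoc[symmetric] feasible_iff
    by (rule Greatest_equality) (use x max in auto)
  with x max that show thesis
    by auto
qed

text \<open>Buying more of the pool than a plan uses never raises profit, so optimizing over
  \<open>z\<close> amounts to maximizing the profit \<phi> of buying exactly what is used. The
  optimal demand is the smallest pool use among the maximizers of \<phi>, and it exists by
  compactness.\<close>

lemma optimal_demand_least:
  shows optimal_demand_nonneg: "0 \<le> optimal_demand A B p c S"
    and lpp_value_le_optimal: "0 \<le> z \<Longrightarrow>
      lpp_value A B p c S z \<le> lpp_value A B p c S (optimal_demand A B p c S)"
    and optimal_demand_le: "0 \<le> z \<Longrightarrow>
      lpp_value A B p c S z = lpp_value A B p c S (optimal_demand A B p c S) \<Longrightarrow>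
      optimal_demand A B p c S \<le> z"
proof -
  let ?v = "lpp_value A B p c S" and ?d = "optimal_demand A B p c S"
  define \<phi> where "\<phi> x = p \<bullet> x - c * (A *v x) $ None" for x
  have cont: "continuous_on T (\<lambda>x. (A *v x) $ None)" for T
    by (intro continuous_on_component matrix_vector_mult_linear_continuous_on)
  then have cont\<phi>: "continuous_on T \<phi>" for T
    unfolding \<phi>_def by (intro continuous_intros)
  obtain xm where xm: "xm \<in> producible S" "\<And>x. x \<in> producible S \<Longrightarrow> \<phi> x \<le> \<phi> xm"
    using continuous_attains_sup[OF compact_producible _ cont\<phi>, of S] zero_producible by blast
  let ?O = "producible S \<inter> {x. \<phi> x = \<phi> xm}"
  have "closed {x. \<phi> x = \<phi> xm}"
    by (intro closed_Collect_eq cont\<phi> continuous_on_const)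
  then have "compact ?O"
    by (rule compact_Int_closed[OF compact_producible])
  then obtain x0 where x0: "x0 \<in> ?O" "\<And>x. x \<in> ?O \<Longrightarrow> (A *v x0) $ None \<le> (A *v x) $ None"
    using continuous_attains_inf[OF _ _ cont, of ?O] xm by blast
  define z0 where "z0 = (A *v x0) $ None"
  have z0: "0 \<le> z0"
    using x0 pool_use_nonneg by (auto simp: z0_def)
  have bound: "?v z \<le> \<phi> xm \<and> (?v z = \<phi> xm \<longrightarrow> z0 \<le> z)" if z: "0 \<le> z" for z
  proof -
    obtain x where x: "x \<in> producible S" "(A *v x) $ None \<le> z" "?v z = p \<bullet> x - c * z"
      using lpp_value_attained[OF z] by metis
    then have 1: "?v z \<le> \<phi> x"
      using c_nonneg by (auto simp: \<phi>_def intro!: mult_left_mono)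
    \<comment> \<open>If \<open>z\<close> attains the maximum, the plan realizing it also maximizes
      \<phi>; it uses at least \<open>z0\<close> and at most \<open>z\<close>.\<close>
    have "z0 \<le> z" if "?v z = \<phi> xm"
    proof -
      have "x \<in> ?O"
        using that 1 xm x by force
      then show ?thesis
        using x0 x unfolding z0_def by force
    qed
    then show ?thesis
      using 1 xm(2)[OF x(1)] by auto
  qed
  have vz0: "?v z0 = \<phi> xm"
  proof (rule antisym)
    have "\<phi> x0 \<le> ?v z0"
      using x0(1) lpp_value_attained[OF z0, of S] by (metis IntE \<phi>_def order_refl z0_def)
    then show "\<phi> xm \<le> ?v z0"
      using x0 by auto
  qed (use bound z0 in blast)
  have "(GREATEST v. \<exists>z'\<ge>0. v = ?v z') = \<phi> xm"
    by (rule Greatest_equality) (use vz0 z0 bound in \<open>auto intro!: exI[of _ z0]\<close>)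
  then have "?d = z0"
    unfolding optimal_demand_def by (intro Least_equality) (use vz0 z0 bound in auto)
  then show "0 \<le> ?d" "0 \<le> z \<Longrightarrow> ?v z \<le> ?v ?d" "0 \<le> z \<Longrightarrow> ?v z = ?v ?d \<Longrightarrow> ?d \<le> z"
    using vz0 z0 bound by auto
qed

section \<open>Shadow prices of the grand coalition\<close>

lemma weak_duality:
  assumes "0 \<le> z" "0 \<le> \<pi>" "\<And>x. 0 \<le> x \<Longrightarrow> p \<bullet> x \<le> \<pi> \<bullet> (A *v x)"
  shows "lpp_value A B p c S z \<le> \<pi> \<bullet> resource_limits (coalition_bundle B S) z - c * z"
proof -
  obtain x where x: "x \<in> producible S" "(A *v x) $ None \<le> z" "lpp_value A B p c S z = p \<bullet> x - c * z"
    using lpp_value_attained[OF assms(1)] by metis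
  then have "0 \<le> x" "A *v x \<le> resource_limits (coalition_bundle B S) z"
    using feasible_iff by blast+
  then have "p \<bullet> x \<le> \<pi> \<bullet> resource_limits (coalition_bundle B S) z"
    using assms inner_left_mono_vec by (meson order_trans)
  then show ?thesis
    using x by simp
qed

text \<open>
  For \<open>r = 0\<close> the resource vector is not strictly positive, but then nothing can be produced and a
  sufficiently high price of the common-pool resource alone is dual optimal.
\<close>
lemma grand_coalition_shadow_prices:
  obtains \<pi> where "0 \<le> \<pi>" "\<And>x. 0 \<le> x \<Longrightarrow> p \<bullet> x \<le> \<pi> \<bullet> (A *v x)"
    "\<pi> \<bullet> resource_limits (coalition_bundle B UNIV) r - c * r = lpp_value A B p c UNIV r"
proof -
  let ?b = "resource_limits (coalition_bundle B UNIV) r" and ?v = "lpp_value A B p c UNIV r"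
  have "\<exists>\<pi>. 0 \<le> \<pi> \<and> (\<forall>x. 0 \<le> x \<longrightarrow> p \<bullet> x \<le> \<pi> \<bullet> (A *v x)) \<and> \<pi> \<bullet> ?b \<le> ?v + c * r"
  proof (cases "r = 0")
    case True
    \<comment> \<open>The sum of these nonnegative ratios dominates each of them, so the pool price
      \<open>w\<close> alone covers the price of every good.\<close>
    define w where "w = (\<Sum>j\<in>UNIV. p $ j / A $ None $ j)"
    have w0: "0 \<le> w"
      unfolding w_def using p_pos A_pool_pos by (intro sum_nonneg) (simp add: less_imp_le)
    have w: "p $ j \<le> w * A $ None $ j" for j
    proof -
      have "p $ j / A $ None $ j \<le> w"
        unfolding w_def using p_pos A_pool_pos by (intro member_le_sum) (auto simp: less_imp_le)
      then show ?thesis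
        using A_pool_pos[of j] by (simp add: field_simps)
    qed
    have "p \<bullet> x \<le> axis None w \<bullet> (A *v x)" if "0 \<le> x" for x
    proof -
      have "p \<bullet> x \<le> (\<Sum>j\<in>UNIV. (w * A $ None $ j) * x $ j)"
        unfolding inner_vec_def inner_real_def
        using that w by (intro sum_mono mult_right_mono) (auto simp: less_eq_vec_def)
      also have "\<dots> = axis None w \<bullet> (A *v x)"
        by (simp add: inner_axis' matrix_vector_mult_def sum_distrib_left mult.assoc)
      finally show ?thesis .
    qed
    moreover have "0 \<le> axis None w"
      using w0 by (auto simp: less_eq_vec_def axis_def)
    moreover have "0 \<le> ?v"
      using lpp_value_attained[OF r_nonneg, of UNIV] zero_producible[of UNIV] True
      by (metis diff_zero inner_zero_right matrix_vector_mult_0_right mult_zero_right order_refl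
          zero_index)
    ultimately show ?thesis
      using True by (intro exI[of _ "axis None w"]) (auto simp: inner_axis')
  next
    case False
    have bpos: "0 < ?b $ k" for k
    proof (cases k)
      case None
      then show ?thesis
        using False r_nonneg by simp
    next
      case (Some t)
      obtain i where "0 < B $ t $ i"
        using B_pos by blast
      then show ?thesis
        using B_nonneg by (auto simp: Some coalition_bundle_nth intro!: sum_pos2[of _ i])
    qed
    have opt: "p \<bullet> x \<le> ?v + c * r" if "0 \<le> x" "A *v x \<le> ?b" for x
      using that feasible_iff[of x UNIV r] lpp_value_attained[OF r_nonneg, of UNIV]
      by (metis diff_le_eq)
    show ?thesis
      by (rule lp_shadow_prices[where b = ?b and V = "?v + c * r" and A = A and p = p])
        (use bpos opt in auto)
  qed
  then obtain \<pi> where \<pi>: "0 \<le> \<pi>" "\<And>x. 0 \<le> x \<Longrightarrow> p \<bullet> x \<le> \<pi> \<bullet> (A *v x)" "\<pi> \<bullet> ?b \<le> ?v + c * r"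
    by blast
  \<comment> \<open>Weak duality at \<open>r\<close> supplies the reverse inequality.\<close>
  with weak_duality[OF r_nonneg \<pi>(1,2), of UNIV] show thesis
    by (intro that[of \<pi>]) auto
qed

text \<open>Moving from \<open>r\<close> to the optimal demand strictly raises the value, since
  equality would make the demand at most \<open>r\<close>. Weak duality bounds this gain by
  \<open>(\<pi> $ None - c)\<close> times the extra amount.\<close>

lemma pool_price_ge_cost:
  assumes d: "r < optimal_demand A B p c UNIV"
    and \<pi>: "0 \<le> \<pi>" "\<And>x. 0 \<le> x \<Longrightarrow> p \<bullet> x \<le> \<pi> \<bullet> (A *v x)"
    and tight: "\<pi> \<bullet> resource_limits (coalition_bundle B UNIV) r - c * r = lpp_value A B p c UNIV r"
  shows "c \<le> \<pi> $ None"
proof -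
  let ?d = "optimal_demand A B p c UNIV" and ?b = "coalition_bundle B UNIV"
  have "lpp_value A B p c UNIV r < lpp_value A B p c UNIV ?d"
    using lpp_value_le_optimal[of r UNIV] optimal_demand_le[of r UNIV] d r_nonneg by fastforce
  also have "\<dots> \<le> \<pi> \<bullet> resource_limits ?b ?d - c * ?d"
    using weak_duality[OF optimal_demand_nonneg \<pi>] .
  also have "\<dots> = lpp_value A B p c UNIV r + (\<pi> $ None - c) * (?d - r)"
    using tight resource_limits_pool_add[of ?b r "?d - r"]
    by (simp add: inner_add_right inner_axis algebra_simps)
  finally show ?thesis
    using d by (simp add: zero_less_mult_iff)
qed

section \<open>Resource games and the core allocation\<close>

lemma pool_game_nonneg:
  assumes "common_pool_resource_game A B p r c R"
  shows "0 \<le> R S"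
proof (cases "S = {}")
  case False
  let ?Ps = "{P. partition_on UNIV P \<and> S \<in> P}"
  \<comment> \<open>Bounding \<open>Min\<close> from below requires a nonempty set of partitions.
    Removing \<open>{}\<close> covers the case \<open>S = UNIV\<close>.\<close>
  have "partition_on UNIV ({S, - S} - {{}})" "S \<in> {S, - S} - {{}}"
    using False by (auto simp: partition_on_def disjoint_def)
  then have "?Ps \<noteq> {}"
    by blast
  moreover have "finite ?Ps"
    by (rule finite)
  ultimately have "0 \<le> R_pes A B p r c S"
    unfolding R_pes_def using optimal_demand_nonneg by (auto simp: Min_ge_iff)
  then show ?thesis
    using assms False by (auto simp: common_pool_resource_game_def intro: order_trans)
qed (use assms in \<open>simp add: common_pool_resource_game_def\<close>)

text \<open>The only partition with \<open>UNIV\<close> as a block is \<open>{UNIV}\<close>, so no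
  outside demand is subtracted and the pessimistic and optimistic amounts coincide.\<close>

lemma pool_game_grand_coalition:
  assumes R: "common_pool_resource_game A B p r c R" and d: "r < optimal_demand A B p c UNIV"
  shows "R UNIV = r"
proof -
  have "T = UNIV" if "partition_on UNIV P" "UNIV \<in> P" "T \<in> P" for P and T :: "'n set"
    using that by (metis disjointD inf_top_right partition_onD2 partition_onD3)
  then have "{P. partition_on UNIV P \<and> (UNIV :: 'n set) \<in> P} = {{UNIV}}"
    by (auto simp: partition_on_space)
  then have "R_pes A B p r c UNIV = r"
    using d r_nonneg by (simp add: R_pes_def)
  moreover have "R_opt A B p r c UNIV = r"
    using d by (simp add: R_opt_def)
  ultimately show ?thesis
    using R by (metis UNIV_not_empty antisym common_pool_resource_game_def)
qed

lemma lpp_game_core_nonempty: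
  assumes R: "common_pool_resource_game A B p r c R"
    and d: "r < optimal_demand A B p c UNIV"
    and y: "y \<in> core R"
  shows "core (lpp_game A B p c R) \<noteq> {}"
proof -
  obtain \<pi> where \<pi>: "0 \<le> \<pi>" "\<And>x. 0 \<le> x \<Longrightarrow> p \<bullet> x \<le> \<pi> \<bullet> (A *v x)"
    and tight: "\<pi> \<bullet> resource_limits (coalition_bundle B UNIV) r - c * r = lpp_value A B p c UNIV r"
    using grand_coalition_shadow_prices by metis
  have RN: "R UNIV = r"
    by (rule pool_game_grand_coalition[OF R d])
  define f where "f = (\<chi> i. \<pi> \<bullet> resource_limits (column i B) (y $ i) - c * y $ i)"
  have f: "(\<Sum>i\<in>S. f $ i) =
      \<pi> \<bullet> resource_limits (coalition_bundle B S) (\<Sum>i\<in>S. y $ i) - c * (\<Sum>i\<in>S. y $ i)" for S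
    by (simp add: f_def sum_subtractf sum_distrib_left coalition_bundle_def
        flip: inner_sum_right sum_resource_limits)
  have "lpp_game A B p c R S \<le> (\<Sum>i\<in>S. f $ i)" for S
  proof -
    let ?b = "coalition_bundle B S" and ?y = "\<Sum>i\<in>S. y $ i"
    \<comment> \<open>In the core of \<open>R\<close>, coalition \<open>S\<close> gets at least
      \<open>R S\<close>, and each surplus unit is worth at least its cost. Hence the payment
      exceeds or equals the weak duality bound at \<open>R S\<close>.\<close>
    have "0 \<le> (\<pi> $ None - c) * (?y - R S)"
      using pool_price_ge_cost[OF d \<pi> tight] y by (simp add: core_def)
    moreover have "\<pi> \<bullet> resource_limits ?b ?y =
        \<pi> \<bullet> resource_limits ?b (R S) + \<pi> $ None * (?y - R S)"
      using resource_limits_pool_add[of ?b "R S" "?y - R S"]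
      by (simp add: inner_add_right inner_axis)
    ultimately show ?thesis
      using weak_duality[OF pool_game_nonneg[OF R] \<pi>, of S S]
      by (simp add: f lpp_game_def algebra_simps)
  qed
  moreover have "(\<Sum>i\<in>UNIV. f $ i) = lpp_game A B p c R UNIV"
    using y RN tight by (simp add: f lpp_game_def core_def)
  ultimately have "f \<in> core (lpp_game A B p c R)"
    by (simp add: core_def)
  then show ?thesis
    by blast
qed

end

theorem theorem13:
  fixes A :: "real^'g^('q::finite option)"
    and B :: "real^'n^'q"
    and p :: "real^'g"
    and r c :: real
    and R :: "'n set \<Rightarrow> real"
  assumes "lpp_situation A B p r c"
    and "common_pool_resource_game A B p r c R"
    and "r < optimal_demand A B p c UNIV"
    and "core R \<noteq> {}"
  shows "core (lpp_game A B p c R) \<noteq> {}"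
  using assms lpp_situation.lpp_game_core_nonempty by blast

end
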